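(* Let $T>0$, let $W^H$ be a fractional Brownian motion with Hurst parameter $H\in(\tfrac12,1)$ on $(\Omega,\mathcal{F},\mathbb{P}^H)$, let $\sigma\in\mathbb{R}$, and let $b:[0,T]\times\Omega\times\mathbb{R}\to\mathbb{R}$. Assume that $b$ is Lipschitz in $x$, i.e. there is a constant $L$ with $|b(t,\omega,x)-b(t,\omega,y)|\le L|x-y|$ for all $t,\omega,x,y$, and that there is a constant $C$ with $|b(t,\omega,x)|\le C(1+|x|)$ for all $t,\omega,x$. Then, for a given initial value $X_0$, the equation $$X_t=X_0+\int_0^t b(s,X_s)\,ds+\sigma W^H_t,\qquad t\in[0,T],$$ has a unique solution $X_t$.
   Context: $\Omega=C_0(\mathbb{R}_+,\mathbb{R})$ is the space of continuous functions on $\mathbb{R}_+$ vanishing at $0$, with its Borel $\sigma$-algebra $\mathcal{F}$ for the topology of local uniform convergence, and $\mathbb{P}^H$ is the probability measure under which the coordinate process $W^H_t(\omega)=\omega(t)$ is a fractional Brownian motion, i.e. a centered Gaussian process with $\mathbb{E}[W^H_sW^H_t]=\tfrac12(t^{2H}+s^{2H}-|t-s|^{2H})$. In the equation, $b(s,X_s)$ means $b(s,\omega,X_s(\omega))$. The function $b$ is assumed jointly measurable so that the integrals make sense. A solution is a process with continuous paths satisfying the integral equation for all $t\in[0,T]$, and uniqueness is pathwise. *)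

theory Defs
  imports "HOL-Probability.Probability"
begin

text \<open>A path on \<open>[0, \<infinity>)\<close> is represented by its extension by \<open>0\<close> to the negative half-line,
  so that equality in the type is equality of paths.\<close>

typedef C0 = "{f :: real \<Rightarrow> real. continuous_on {0..} f \<and> (\<forall>t\<le>0. f t = 0)}"
  morphisms coord Abs_C0
  by (rule exI[of _ "\<lambda>_. 0"]) auto

text \<open>The topology of local uniform convergence; \<open>borel\<close> on \<open>C0\<close> refers to it.\<close>

instantiation C0 :: topological_space
begin

definition open_C0 :: "C0 set \<Rightarrow> bool" where
  "open_C0 U \<longleftrightarrow>
    (\<forall>f\<in>U. \<exists>R>0. \<exists>e>0. {g. \<forall>t\<in>{0..R}. \<bar>coord g t - coord f t\<bar> < e} \<subseteq> U)"

instance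
proof
  show "open (UNIV :: C0 set)"
    unfolding open_C0_def by (auto intro!: exI[of _ "1::real"])
next
  fix U V :: "C0 set"
  assume U: "open U" and V: "open V"
  show "open (U \<inter> V)"
    unfolding open_C0_def
  proof
    fix f assume f: "f \<in> U \<inter> V"
    obtain R e where Re: "R > 0" "e > 0"
        "{g. \<forall>t\<in>{0..R}. \<bar>coord g t - coord f t\<bar> < e} \<subseteq> U"
      using U f unfolding open_C0_def by blast
    obtain S d where Sd: "S > 0" "d > 0"
        "{g. \<forall>t\<in>{0..S}. \<bar>coord g t - coord f t\<bar> < d} \<subseteq> V"
      using V f unfolding open_C0_def by blast
    have "{g. \<forall>t\<in>{0..max R S}. \<bar>coord g t - coord f t\<bar> < min e d} \<subseteq> U \<inter> V"
      using Re(3) Sd(3) by fastforce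
    moreover have "max R S > 0" "min e d > 0"
      using Re Sd by auto
    ultimately show "\<exists>R>0. \<exists>e>0. {g. \<forall>t\<in>{0..R}. \<bar>coord g t - coord f t\<bar> < e} \<subseteq> U \<inter> V"
      by blast
  qed
next
  fix K :: "C0 set set"
  assume K: "\<forall>U\<in>K. open U"
  show "open (\<Union>K)"
    unfolding open_C0_def
  proof
    fix f assume "f \<in> \<Union>K"
    then obtain U where U: "U \<in> K" "f \<in> U"
      by blast
    then obtain R e where "R > 0" "e > 0"
        "{g. \<forall>t\<in>{0..R}. \<bar>coord g t - coord f t\<bar> < e} \<subseteq> U"
      using K unfolding open_C0_def by blast
    with U(1) show "\<exists>R>0. \<exists>e>0. {g. \<forall>t\<in>{0..R}. \<bar>coord g t - coord f t\<bar> < e} \<subseteq> \<Union>K"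
      by blast
  qed
qed

end

text \<open>Almost surely constant variables count as (degenerate) Gaussian variables; this is needed
  for linear combinations, e.g.\ already for the value at time \<open>0\<close>.\<close>

definition gaussian_rv :: "'a measure \<Rightarrow> ('a \<Rightarrow> real) \<Rightarrow> bool" where
  "gaussian_rv M Y \<longleftrightarrow> Y \<in> borel_measurable M \<and>
    ((\<exists>m s. s > 0 \<and> distributed M lborel Y (normal_density m s)) \<or>
     (\<exists>m. AE \<omega> in M. Y \<omega> = m))"

definition gaussian_process :: "'a measure \<Rightarrow> 'i set \<Rightarrow> ('i \<Rightarrow> 'a \<Rightarrow> real) \<Rightarrow> bool" where
  "gaussian_process M I X \<longleftrightarrow>
    (\<forall>J a. finite J \<and> J \<subseteq> I \<longrightarrow> gaussian_rv M (\<lambda>\<omega>. \<Sum>t\<in>J. a t * X t \<omega>))"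

definition fractional_brownian_motion ::
    "'a measure \<Rightarrow> real \<Rightarrow> (real \<Rightarrow> 'a \<Rightarrow> real) \<Rightarrow> bool" where
  "fractional_brownian_motion M H W \<longleftrightarrow>
    gaussian_process M {0..} W \<and>
    (\<forall>t\<ge>0. integrable M (W t) \<and> (\<integral>\<omega>. W t \<omega> \<partial>M) = 0) \<and>
    (\<forall>s\<ge>0. \<forall>t\<ge>0. integrable M (\<lambda>\<omega>. W s \<omega> * W t \<omega>) \<and>
      (\<integral>\<omega>. W s \<omega> * W t \<omega> \<partial>M) =
        (t powr (2 * H) + s powr (2 * H) - \<bar>t - s\<bar> powr (2 * H)) / 2)"

text \<open>The equation along one fixed \<open>\<omega>\<close>, for a continuous path \<open>x\<close> with initial value \<open>x0\<close>.\<close>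

definition solves_path ::
    "real \<Rightarrow> (real \<Rightarrow> C0 \<Rightarrow> real \<Rightarrow> real) \<Rightarrow> real \<Rightarrow> real \<Rightarrow> C0 \<Rightarrow> (real \<Rightarrow> real) \<Rightarrow> bool" where
  "solves_path T b \<sigma> x0 \<omega> x \<longleftrightarrow>
    continuous_on {0..T} x \<and>
    (\<forall>t\<in>{0..T}. set_integrable lborel {0..t} (\<lambda>s. b s \<omega> (x s)) \<and>
      x t = x0 + (LINT s:{0..t}|lborel. b s \<omega> (x s)) + \<sigma> * coord \<omega> t)"

definition is_solution ::
    "C0 measure \<Rightarrow> real \<Rightarrow> (real \<Rightarrow> C0 \<Rightarrow> real \<Rightarrow> real) \<Rightarrow> real \<Rightarrow> (C0 \<Rightarrow> real) \<Rightarrow>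
      (real \<Rightarrow> C0 \<Rightarrow> real) \<Rightarrow> bool" where
  "is_solution P T b \<sigma> X0 X \<longleftrightarrow>
    (\<forall>t\<in>{0..T}. X t \<in> borel_measurable P) \<and>
    (\<forall>\<omega>. solves_path T b \<sigma> (X0 \<omega>) \<omega> (\<lambda>t. X t \<omega>))"

definition is_as_solution ::
    "C0 measure \<Rightarrow> real \<Rightarrow> (real \<Rightarrow> C0 \<Rightarrow> real \<Rightarrow> real) \<Rightarrow> real \<Rightarrow> (C0 \<Rightarrow> real) \<Rightarrow>
      (real \<Rightarrow> C0 \<Rightarrow> real) \<Rightarrow> bool" where
  "is_as_solution P T b \<sigma> X0 X \<longleftrightarrow>
    (\<forall>t\<in>{0..T}. X t \<in> borel_measurable P) \<and>
    (AE \<omega> in P. solves_path T b \<sigma> (X0 \<omega>) \<omega> (\<lambda>t. X t \<omega>))"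

end

theory Submission imports Defs begin

text \<open>
  The noise enters the equation additively, so for each fixed \<open>\<omega>\<close> the equation is the
  deterministic integral equation \<open>x t = g t + (LINT s:{0..t}|lborel. f s (x s))\<close> with the
  continuous forcing term \<open>g t = X0 \<omega> + \<sigma> * coord \<omega> t\<close> and the Lipschitz right-hand side
  \<open>f s = b s \<omega>\<close>.  Measured in the weighted supremum norm
  \<open>sup\<^sub>t e\<^sup>-\<^sup>2\<^sup>L\<^sup>t \<bar>x t\<bar>\<close>, the right-hand side of this equation contracts by the factor \<open>1/2\<close>
  (\<open>volterra_contraction\<close>).  This gives uniqueness on the whole interval at once
  (\<open>volterra_unique\<close>) and uniform convergence of the Picard iterates to a solution
  (\<open>picard_converges\<close>).

  The one probabilistic point is that the solution is a random variable at each time.  Each Picard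
  iterate is one: it has continuous paths, hence is jointly measurable in time and \<open>\<omega>\<close> as
  soon as it is measurable at each fixed time (\<open>measurable_pair_continuous_paths\<close>), and
  then its integral over time is again measurable in \<open>\<omega>\<close> by Fubini's theorem
  (\<open>measurable_picard\<close>).  The solution inherits measurability as their pointwise limit.

  Uniqueness holds path by path.  Two solutions therefore agree at every \<open>\<omega>\<close> at which both
  satisfy the equation, which gives the sure and the almost sure version alike.
\<close>

section \<open>Volterra equations with a Lipschitz right-hand side\<close>

definition volterra :: "(real \<Rightarrow> real \<Rightarrow> real) \<Rightarrow> (real \<Rightarrow> real) \<Rightarrow> (real \<Rightarrow> real) \<Rightarrow> real \<Rightarrow> real" where
  "volterra f g x t = g t + (LINT s:{0..t}|lborel. f s (x s))"

locale lipschitz_drift =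
  fixes f :: "real \<Rightarrow> real \<Rightarrow> real" and T L C :: real
  assumes L_pos: "L > 0"
    and drift_measurable:
      "(\<lambda>(s, x). f s x) \<in> borel_measurable (restrict_space borel {0..T} \<Otimes>\<^sub>M borel)"
    and drift_lipschitz: "s \<in> {0..T} \<Longrightarrow> \<bar>f s x - f s y\<bar> \<le> L * \<bar>x - y\<bar>"
    and drift_growth: "s \<in> {0..T} \<Longrightarrow> \<bar>f s x\<bar> \<le> C * (1 + \<bar>x\<bar>)"
begin

text \<open>A continuous path is bounded on the compact interval, and linear growth of \<open>f\<close> then
  makes the integrand bounded.\<close>

lemma drift_integrable:
  assumes x: "continuous_on {0..T} x" and t: "t \<in> {0..T}"
  shows "set_integrable lborel {0..t} (\<lambda>s. f s (x s))"
proof -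
  have "x \<in> borel_measurable (restrict_space borel {0..T})"
    using x by (rule borel_measurable_continuous_on_restrict)
  then have "(\<lambda>s. (s, x s)) \<in> restrict_space borel {0..T} \<rightarrow>\<^sub>M restrict_space borel {0..T} \<Otimes>\<^sub>M borel"
    by measurable
  from measurable_compose[OF this drift_measurable]
  have "(\<lambda>s. f s (x s)) \<in> borel_measurable (restrict_space borel {0..T})"
    by simp
  then have meas: "(\<lambda>s. indicator {0..T} s *\<^sub>R f s (x s)) \<in> borel_measurable lborel"
    by (subst (asm) borel_measurable_restrict_space_iff) auto
  have "bounded (x ` {0..T})"
    by (intro compact_imp_bounded compact_continuous_image x compact_Icc)
  then obtain B where B: "\<bar>x s\<bar> \<le> B" if "s \<in> {0..T}" for s
    unfolding bounded_iff by (metis imageI real_norm_def)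
  have bound: "\<bar>f s (x s)\<bar> \<le> \<bar>C\<bar> * (1 + B)" if s: "s \<in> {0..T}" for s
  proof -
    have "C * (1 + \<bar>x s\<bar>) \<le> \<bar>C\<bar> * (1 + B)"
      using B[OF s] by (intro mult_mono) auto
    with drift_growth[OF s, of "x s"] show ?thesis by linarith
  qed
  have "integrable lborel (\<lambda>s. indicator {0..t} s *\<^sub>R (indicator {0..T} s *\<^sub>R f s (x s)))"
    using t bound meas
    by (intro integrableI_bounded_set_indicator[where B="\<bar>C\<bar> * (1 + B)"])
       (auto intro!: AE_I2 simp: indicator_def)
  then show ?thesis
    unfolding set_integrable_def
    by (rule Bochner_Integration.integrable_cong[THEN iffD1, rotated -1])
       (use t in \<open>auto simp: indicator_def\<close>)
qed

lemma continuous_on_volterra: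
  assumes g: "continuous_on {0..T} g" and x: "continuous_on {0..T} x"
  shows "continuous_on {0..T} (volterra f g x)"
proof (cases "T \<ge> 0")
  case True
  have int: "(\<lambda>s. f s (x s)) integrable_on {0..T}"
    using set_borel_integral_eq_integral(1)[OF drift_integrable[OF x]] True by auto
  have "continuous_on {0..T} (\<lambda>t. g t + integral {0..t} (\<lambda>s. f s (x s)))"
    by (intro continuous_intros g indefinite_integral_continuous_1 int)
  then show ?thesis
    by (rule continuous_on_eq)
       (simp add: volterra_def set_borel_integral_eq_integral(2)[OF drift_integrable[OF x]])
qed simp

text \<open>The weight \<open>exp (2 L t)\<close> is chosen because integrating it against the Lipschitz
  constant returns at most half of it.\<close>

lemma volterra_contraction:
  assumes x: "continuous_on {0..T} x" and y: "continuous_on {0..T} y"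
    and K: "\<And>s. s \<in> {0..T} \<Longrightarrow> \<bar>x s - y s\<bar> \<le> K * exp (2 * L * s)"
    and t: "t \<in> {0..T}"
  shows "\<bar>volterra f g x t - volterra f g y t\<bar> \<le> K / 2 * exp (2 * L * t)"
proof -
  note ix = set_borel_integral_eq_integral[OF drift_integrable[OF x t]]
  note iy = set_borel_integral_eq_integral[OF drift_integrable[OF y t]]
  have "0 \<in> {0..T}" using t by auto
  from K[OF this] have K0: "K \<ge> 0" by simp
  have weight: "((\<lambda>s. L * (K * exp (2 * L * s))) has_integral
      (K / 2 * exp (2 * L * t) - K / 2 * exp (2 * L * 0))) {0..t}"
    using t by (intro fundamental_theorem_of_calculus)
      (auto intro!: derivative_eq_intros simp: has_real_derivative_iff_has_vector_derivative[symmetric])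
  have "volterra f g x t - volterra f g y t = integral {0..t} (\<lambda>s. f s (x s) - f s (y s))"
    unfolding volterra_def ix(2) iy(2)
    by (simp add: Henstock_Kurzweil_Integration.integral_diff[OF ix(1) iy(1)])
  also have "norm \<dots> \<le> integral {0..t} (\<lambda>s. L * (K * exp (2 * L * s)))"
  proof (rule integral_norm_bound_integral)
    fix s assume "s \<in> {0..t}"
    then have s: "s \<in> {0..T}" using t by auto
    have "\<bar>f s (x s) - f s (y s)\<bar> \<le> L * \<bar>x s - y s\<bar>" by (rule drift_lipschitz[OF s])
    also have "\<dots> \<le> L * (K * exp (2 * L * s))"
      using K[OF s] L_pos by (intro mult_left_mono) auto
    finally show "norm (f s (x s) - f s (y s)) \<le> L * (K * exp (2 * L * s))" by simp
  qed (use ix(1) iy(1) weight in \<open>auto intro: integrable_diff\<close>)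
  also have "\<dots> \<le> K / 2 * exp (2 * L * t)"
    using K0 unfolding integral_unique[OF weight] by simp
  finally show ?thesis by simp
qed

text \<open>The difference of two solutions is bounded, and applying the contraction estimate to it
  repeatedly halves the bound each time.\<close>

lemma volterra_unique:
  assumes x: "continuous_on {0..T} x" "\<And>t. t \<in> {0..T} \<Longrightarrow> x t = volterra f g x t"
    and y: "continuous_on {0..T} y" "\<And>t. t \<in> {0..T} \<Longrightarrow> y t = volterra f g y t"
    and t: "t \<in> {0..T}"
  shows "x t = y t"
proof -
  have "bounded ((\<lambda>s. x s - y s) ` {0..T})"
    by (intro compact_imp_bounded compact_continuous_image continuous_intros x y compact_Icc)
  then obtain K where K: "\<And>s. s \<in> {0..T} \<Longrightarrow> \<bar>x s - y s\<bar> \<le> K"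
    unfolding bounded_iff by (metis imageI real_norm_def)
  have est: "\<bar>x s - y s\<bar> \<le> K / 2 ^ n * exp (2 * L * s)" if "s \<in> {0..T}" for n s
    using that
  proof (induction n arbitrary: s)
    case 0
    have "K * 1 \<le> K * exp (2 * L * s)"
      using K[OF 0] 0 L_pos by (intro mult_left_mono) auto
    with K[OF 0] show ?case by simp
  next
    case (Suc n)
    from volterra_contraction[OF x(1) y(1) Suc.IH Suc.prems, of g] x(2) y(2) Suc.prems
    show ?case by (simp add: mult.commute)
  qed
  have "(\<lambda>n. K * exp (2 * L * t) * (1 / 2) ^ n) \<longlonglongrightarrow> K * exp (2 * L * t) * 0"
    by (intro tendsto_intros) auto
  then have "\<bar>x t - y t\<bar> \<le> K * exp (2 * L * t) * 0"
    by (rule LIMSEQ_le_const) (use est[OF t] in \<open>auto simp: power_divide\<close>)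
  then show ?thesis by simp
qed

lemma continuous_on_picard:
  assumes "continuous_on {0..T} g"
  shows "continuous_on {0..T} ((volterra f g ^^ n) g)"
  by (induction n) (auto intro: assms continuous_on_volterra)

text \<open>By contraction, consecutive Picard iterates differ by a geometric sequence uniformly in time,
  so the Weierstrass test applies to their telescoping series.  A uniform limit of the iterates is
  continuous, and it is a fixed point since the contraction estimate also makes the
  Volterra operator continuous.\<close>

lemma picard_converges:
  assumes g: "continuous_on {0..T} g"
  obtains x where "continuous_on {0..T} x" "\<And>t. t \<in> {0..T} \<Longrightarrow> x t = volterra f g x t"
    "\<And>t. t \<in> {0..T} \<Longrightarrow> (\<lambda>n. (volterra f g ^^ n) g t) \<longlonglongrightarrow> x t"
proof -
  define p where "p n = (volterra f g ^^ n) g" for n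
  have p_Suc: "p (Suc n) = volterra f g (p n)" for n
    by (simp add: p_def)
  have p_cont: "continuous_on {0..T} (p n)" for n
    unfolding p_def by (rule continuous_on_picard[OF g])
  have "bounded ((\<lambda>s. p 1 s - p 0 s) ` {0..T})"
    by (intro compact_imp_bounded compact_continuous_image continuous_intros p_cont compact_Icc)
  then obtain K where K: "\<And>s. s \<in> {0..T} \<Longrightarrow> \<bar>p 1 s - p 0 s\<bar> \<le> K"
    unfolding bounded_iff by (metis imageI real_norm_def)
  have est: "\<bar>p (Suc n) s - p n s\<bar> \<le> K / 2 ^ n * exp (2 * L * s)" if "s \<in> {0..T}" for n s
    using that
  proof (induction n arbitrary: s)
    case 0
    have "K * 1 \<le> K * exp (2 * L * s)"
      using K[OF 0] 0 L_pos by (intro mult_left_mono) auto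
    with K[OF 0] show ?case by simp
  next
    case (Suc n)
    from volterra_contraction[OF p_cont p_cont Suc.IH Suc.prems, of g]
    show ?case by (simp add: mult.commute p_Suc)
  qed
  have bound: "norm (p (Suc n) s - p n s) \<le> K * exp (2 * L * T) * (1 / 2) ^ n"
    if s: "s \<in> {0..T}" for n s
  proof -
    have "K \<ge> 0" using K[OF s] by linarith
    then have "K / 2 ^ n * exp (2 * L * s) \<le> K / 2 ^ n * exp (2 * L * T)"
      using s L_pos by (intro mult_left_mono) auto
    with est[OF s, of n] show ?thesis by (simp add: power_divide)
  qed
  define x where "x s = p 0 s + (\<Sum>n. p (Suc n) s - p n s)" for s
  have "uniform_limit {0..T} (\<lambda>n s. \<Sum>i<n. p (Suc i) s - p i s) (\<lambda>s. \<Sum>n. p (Suc n) s - p n s) sequentially"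
    by (rule Weierstrass_m_test[OF bound]) (auto intro!: summable_mult summable_geometric)
  then have "uniform_limit {0..T} (\<lambda>n s. p 0 s + (\<Sum>i<n. p (Suc i) s - p i s)) x sequentially"
    unfolding x_def by (intro uniform_limit_intros)
  moreover have "p 0 s + (\<Sum>i<n. p (Suc i) s - p i s) = p n s" for n s
    using sum_lessThan_telescope[of "\<lambda>i. p i s" n] by simp
  ultimately have unif: "uniform_limit {0..T} p x sequentially"
    by simp
  have x_cont: "continuous_on {0..T} x"
    by (rule uniform_limit_theorem[OF _ unif]) (simp_all add: p_cont)
  have lim: "(\<lambda>n. p n t) \<longlonglongrightarrow> x t" if "t \<in> {0..T}" for t
    by (rule tendsto_uniform_limitI[OF unif that])
  have "x t = volterra f g x t" if t: "t \<in> {0..T}" for t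
  proof -
    have "(\<lambda>n. volterra f g (p n) t) \<longlonglongrightarrow> volterra f g x t"
    proof (rule tendstoI)
      fix e :: real assume e: "e > 0"
      define d where "d = e / exp (2 * L * t)"
      have d: "d > 0" using e by (simp add: d_def)
      from uniform_limitD[OF unif d]
      show "\<forall>\<^sub>F n in sequentially. dist (volterra f g (p n) t) (volterra f g x t) < e"
      proof eventually_elim
        case (elim n)
        have "\<bar>p n s - x s\<bar> \<le> d * exp (2 * L * s)" if s: "s \<in> {0..T}" for s
        proof -
          have "d * 1 \<le> d * exp (2 * L * s)"
            using d s L_pos by (intro mult_left_mono) auto
          with elim s show ?thesis by (force simp: dist_real_def)
        qed
        from volterra_contraction[OF p_cont x_cont this t, of g]
        have "\<bar>volterra f g (p n) t - volterra f g x t\<bar> \<le> e / 2" by (simp add: d_def)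
        with e show ?case by (simp add: dist_real_def)
      qed
    qed
    moreover have "(\<lambda>n. volterra f g (p n) t) \<longlonglongrightarrow> x t"
      using LIMSEQ_Suc[OF lim[OF t]] by (simp add: p_Suc)
    ultimately show ?thesis by (rule LIMSEQ_unique[rotated])
  qed
  then show ?thesis
    by (rule that[OF x_cont _ lim[unfolded p_def]])
qed

end

section \<open>Measurability of the Picard iterates\<close>

text \<open>A process with continuous paths is the limit of its discretisations in time, and these
  are jointly measurable because they take only countably many times into account.  Rounding the
  time down keeps it inside the interval.\<close>

lemma measurable_pair_continuous_paths:
  fixes Z :: "real \<Rightarrow> 'w \<Rightarrow> real"
  assumes Z: "\<And>t. t \<in> {0..T} \<Longrightarrow> Z t \<in> borel_measurable M"
    and cont: "\<And>\<omega>. \<omega> \<in> space M \<Longrightarrow> continuous_on {0..T} (\<lambda>t. Z t \<omega>)"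
  shows "(\<lambda>(t, \<omega>). Z t \<omega>) \<in> borel_measurable (restrict_space borel {0..T} \<Otimes>\<^sub>M M)"
proof -
  let ?N = "restrict_space borel {0..T} \<Otimes>\<^sub>M M"
  define r where "r n k = real k / real (Suc n)" for n k
  define k where "k n t = nat \<lfloor>t * real (Suc n)\<rfloor>" for n and t :: real
  \<comment> \<open>Grid points beyond \<open>T\<close> are never reached; the value \<open>0\<close> there keeps each
    grid-point variable measurable.\<close>
  define D where "D n j p = (if r n j \<in> {0..T} then Z (r n j) (snd p) else 0)"
    for n j and p :: "real \<times> 'w"
  have near: "r n (k n t) \<le> t" "t - 1 / real (Suc n) \<le> r n (k n t)" "0 \<le> r n (k n t)"
    if "t \<ge> 0" for n t
  proof -
    have "real (k n t) = of_int \<lfloor>t * real (Suc n)\<rfloor>"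
      using that by (simp add: k_def)
    then have le: "real (k n t) \<le> t * real (Suc n)" and ge: "t * real (Suc n) \<le> real (k n t) + 1"
      by linarith+
    show "r n (k n t) \<le> t" "0 \<le> r n (k n t)"
      using le by (simp_all add: r_def pos_divide_le_eq del: of_nat_Suc)
    have "t \<le> (real (k n t) + 1) / real (Suc n)"
      using ge by (simp add: pos_le_divide_eq del: of_nat_Suc)
    then show "t - 1 / real (Suc n) \<le> r n (k n t)"
      by (simp add: r_def add_divide_distrib)
  qed
  have fst_meas: "fst \<in> borel_measurable ?N"
    by (rule measurable_compose[OF measurable_fst measurable_restrict_space1]) simp
  have D_meas: "(\<lambda>p. D n (k n (fst p)) p) \<in> borel_measurable ?N" for n
  proof (rule measurable_compose_countable)
    fix j show "(\<lambda>p. D n j p) \<in> borel_measurable ?N"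
      unfolding D_def using measurable_compose[OF measurable_snd Z] by (cases "r n j \<in> {0..T}") auto
  next
    show "(\<lambda>p. k n (fst p)) \<in> ?N \<rightarrow>\<^sub>M count_space UNIV"
      unfolding k_def using fst_meas by measurable
  qed
  show ?thesis
  proof (rule borel_measurable_LIMSEQ_real[OF _ D_meas])
    fix p assume "p \<in> space ?N"
    then obtain t \<omega> where p: "p = (t, \<omega>)" and t: "t \<in> {0..T}" and \<omega>: "\<omega> \<in> space M"
      by (auto simp: space_pair_measure space_restrict_space)
    have in_T: "r n (k n t) \<in> {0..T}" for n
      using near[of t n] t by auto
    have "(\<lambda>n. t - 1 / real (Suc n)) \<longlonglongrightarrow> t - 0"
      by (intro tendsto_intros LIMSEQ_Suc lim_1_over_n)
    then have "(\<lambda>n. t - 1 / real (Suc n)) \<longlonglongrightarrow> t"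
      by simp
    then have "(\<lambda>n. r n (k n t)) \<longlonglongrightarrow> t"
      by (rule tendsto_sandwich[rotated 2, OF _ tendsto_const]) (use near t in auto)
    then have "(\<lambda>n. Z (r n (k n t)) \<omega>) \<longlonglongrightarrow> Z t \<omega>"
      by (rule continuous_on_tendsto_compose[OF cont[OF \<omega>]]) (use t in_T in auto)
    then show "(\<lambda>n. D n (k n (fst p)) p) \<longlonglongrightarrow> (case p of (t, \<omega>) \<Rightarrow> Z t \<omega>)"
      using in_T by (simp add: p D_def)
  qed
qed

lemma measurable_time_integral:
  fixes h :: "real \<Rightarrow> 'w \<Rightarrow> real"
  assumes h: "(\<lambda>(s, \<omega>). h s \<omega>) \<in> borel_measurable (restrict_space borel {0..T} \<Otimes>\<^sub>M M)"
    and t: "t \<in> {0..T}"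
  shows "(\<lambda>\<omega>. LINT s:{0..t}|lborel. h s \<omega>) \<in> borel_measurable M"
proof -
  let ?R = "restrict_space lborel {0..t}"
  interpret R: finite_measure ?R
    by standard (use t in \<open>auto simp: emeasure_restrict_space space_restrict_space\<close>)
  have "(\<lambda>s. s) \<in> ?R \<rightarrow>\<^sub>M restrict_space borel {0..T}"
    using t by (intro measurable_restrict_space3) auto
  then have "(\<lambda>p. (snd p, fst p)) \<in> M \<Otimes>\<^sub>M ?R \<rightarrow>\<^sub>M restrict_space borel {0..T} \<Otimes>\<^sub>M M"
    by (intro measurable_Pair measurable_compose[OF measurable_snd] measurable_fst)
  from measurable_compose[OF this h]
  have "(\<lambda>(\<omega>, s). h s \<omega>) \<in> borel_measurable (M \<Otimes>\<^sub>M ?R)"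
    by (simp add: case_prod_beta)
  then have "(\<lambda>\<omega>. \<integral>s. h s \<omega> \<partial>?R) \<in> borel_measurable M"
    by (rule R.borel_measurable_lebesgue_integral)
  then show ?thesis
    by (simp add: integral_restrict_space set_lebesgue_integral_def)
qed

text \<open>The induction is over all times simultaneously, because one Picard step at time \<open>t\<close>
  integrates the previous iterate over all earlier times.\<close>

lemma measurable_picard:
  fixes b :: "real \<Rightarrow> 'w \<Rightarrow> real \<Rightarrow> real" and g :: "'w \<Rightarrow> real \<Rightarrow> real"
  assumes drift: "\<And>\<omega>. \<omega> \<in> space M \<Longrightarrow> lipschitz_drift (\<lambda>s. b s \<omega>) T L C"
    and b: "(\<lambda>(s, \<omega>, x). b s \<omega> x) \<in> borel_measurable (restrict_space borel {0..T} \<Otimes>\<^sub>M M \<Otimes>\<^sub>M borel)"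
    and g: "\<And>t. t \<in> {0..T} \<Longrightarrow> (\<lambda>\<omega>. g \<omega> t) \<in> borel_measurable M"
    and g_cont: "\<And>\<omega>. \<omega> \<in> space M \<Longrightarrow> continuous_on {0..T} (g \<omega>)"
    and t: "t \<in> {0..T}"
  shows "(\<lambda>\<omega>. (volterra (\<lambda>s. b s \<omega>) (g \<omega>) ^^ n) (g \<omega>) t) \<in> borel_measurable M"
  using t
proof (induction n arbitrary: t)
  case 0
  then show ?case by (simp add: g)
next
  case (Suc n)
  let ?N = "restrict_space borel {0..T} \<Otimes>\<^sub>M M"
  define Z where "Z s \<omega> = (volterra (\<lambda>s. b s \<omega>) (g \<omega>) ^^ n) (g \<omega>) s" for s \<omega>
  have "(\<lambda>(s, \<omega>). Z s \<omega>) \<in> borel_measurable ?N"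
    unfolding Z_def
    by (intro measurable_pair_continuous_paths Suc.IH lipschitz_drift.continuous_on_picard[OF drift] g_cont)
  then have "(\<lambda>(s, \<omega>). (s, \<omega>, Z s \<omega>)) \<in> ?N \<rightarrow>\<^sub>M restrict_space borel {0..T} \<Otimes>\<^sub>M M \<Otimes>\<^sub>M borel"
    unfolding case_prod_beta by measurable
  from measurable_compose[OF this b]
  have "(\<lambda>(s, \<omega>). b s \<omega> (Z s \<omega>)) \<in> borel_measurable ?N"
    by (simp add: case_prod_beta)
  from borel_measurable_add[OF g measurable_time_integral[OF this], OF Suc.prems Suc.prems]
  have "(\<lambda>\<omega>. volterra (\<lambda>s. b s \<omega>) (g \<omega>) (\<lambda>s. Z s \<omega>) t) \<in> borel_measurable M"
    unfolding volterra_def .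
  then show ?case by (simp add: Z_def)
qed

section \<open>The noise on path space\<close>

lemma continuous_on_coord: "continuous_on {0..T} (coord \<omega>)"
  using coord[of \<omega>] by (auto elim: continuous_on_subset)

lemma measurable_coord: "(\<lambda>\<omega>. coord \<omega> t) \<in> borel_measurable borel"
proof (cases "t \<le> 0")
  case True
  then have "coord \<omega> t = 0" for \<omega>
    using coord[of \<omega>] by auto
  then show ?thesis by simp
next
  case False
  have "open {\<omega>. coord \<omega> t < a}" for a
    unfolding open_C0_def
  proof
    fix f assume "f \<in> {\<omega>. coord \<omega> t < a}"
    then have e: "a - coord f t > 0"
      by simp
    have "{g. \<forall>s\<in>{0..t}. \<bar>coord g s - coord f s\<bar> < a - coord f t} \<subseteq> {\<omega>. coord \<omega> t < a}"
    proof clarify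
      fix g assume "\<forall>s\<in>{0..t}. \<bar>coord g s - coord f s\<bar> < a - coord f t"
      from bspec[OF this, of t] show "coord g t < a"
        using False by simp
    qed
    with e False show "\<exists>R>0. \<exists>e>0. {g. \<forall>s\<in>{0..R}. \<bar>coord g s - coord f s\<bar> < e} \<subseteq> {\<omega>. coord \<omega> t < a}"
      by (intro exI[of _ t] conjI exI[of _ "a - coord f t"]) auto
  qed
  then show ?thesis
    by (auto intro!: borel_measurableI_less borel_open)
qed

section \<open>Existence and uniqueness for the stochastic equation\<close>

theorem theorem5p1:
  fixes T H \<sigma> :: real
    and P :: "C0 measure"
    and b :: "real \<Rightarrow> C0 \<Rightarrow> real \<Rightarrow> real"
    and X0 :: "C0 \<Rightarrow> real"
  assumes "T > 0"
    and "1 / 2 < H" and "H < 1"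
    and "prob_space P" and "sets P = sets borel"
    and "fractional_brownian_motion P H (\<lambda>t \<omega>. coord \<omega> t)"
    and "(\<lambda>(t, \<omega>, x). b t \<omega> x) \<in>
      borel_measurable (restrict_space borel {0..T} \<Otimes>\<^sub>M P \<Otimes>\<^sub>M borel)"
    and "\<exists>L. \<forall>t\<in>{0..T}. \<forall>\<omega> x y. \<bar>b t \<omega> x - b t \<omega> y\<bar> \<le> L * \<bar>x - y\<bar>"
    and "\<exists>C. \<forall>t\<in>{0..T}. \<forall>\<omega> x. \<bar>b t \<omega> x\<bar> \<le> C * (1 + \<bar>x\<bar>)"
    and "X0 \<in> borel_measurable P"
  shows "\<exists>X. is_solution P T b \<sigma> X0 X \<and>
    (\<forall>Y. is_solution P T b \<sigma> X0 Y \<longrightarrow> (\<forall>\<omega>. \<forall>t\<in>{0..T}. Y t \<omega> = X t \<omega>)) \<and>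
    (\<forall>Y. is_as_solution P T b \<sigma> X0 Y \<longrightarrow> (AE \<omega> in P. \<forall>t\<in>{0..T}. Y t \<omega> = X t \<omega>))"
proof -
  from assms(8) obtain L0 where L0: "\<And>t \<omega> x y. t \<in> {0..T} \<Longrightarrow> \<bar>b t \<omega> x - b t \<omega> y\<bar> \<le> L0 * \<bar>x - y\<bar>"
    by blast
  from assms(9) obtain C where C: "\<And>t \<omega> x. t \<in> {0..T} \<Longrightarrow> \<bar>b t \<omega> x\<bar> \<le> C * (1 + \<bar>x\<bar>)"
    by blast
  \<comment> \<open>The weight in the contraction estimate needs a strictly positive Lipschitz constant.\<close>
  define L where "L = \<bar>L0\<bar> + 1"
  define g where "g \<omega> t = X0 \<omega> + \<sigma> * coord \<omega> t" for \<omega> t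
  have space_P: "space P = UNIV"
    using sets_eq_imp_space_eq[OF assms(5)] by simp
  have drift: "lipschitz_drift (\<lambda>s. b s \<omega>) T L C" for \<omega>
  proof
    show "L > 0" by (simp add: L_def)
    have "(\<lambda>_. \<omega>) \<in> restrict_space borel {0..T} \<Otimes>\<^sub>M (borel :: real measure) \<rightarrow>\<^sub>M P"
      by (rule measurable_const) (simp add: space_P)
    then have "(\<lambda>(s, x). (s, \<omega>, x)) \<in> restrict_space borel {0..T} \<Otimes>\<^sub>M borel
        \<rightarrow>\<^sub>M restrict_space borel {0..T} \<Otimes>\<^sub>M P \<Otimes>\<^sub>M (borel :: real measure)"
      unfolding case_prod_beta
      by (intro measurable_Pair measurable_fst measurable_snd)
    from measurable_compose[OF this assms(7)]
    show "(\<lambda>(s, x). b s \<omega> x) \<in> borel_measurable (restrict_space borel {0..T} \<Otimes>\<^sub>M borel)"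
      by (simp add: case_prod_beta)
    fix s x y assume s: "s \<in> {0..T}"
    have "L0 * \<bar>x - y\<bar> \<le> L * \<bar>x - y\<bar>"
      by (intro mult_right_mono) (auto simp: L_def)
    with L0[OF s] show "\<bar>b s \<omega> x - b s \<omega> y\<bar> \<le> L * \<bar>x - y\<bar>"
      by (meson order_trans)
  qed (rule C)
  have g_cont: "continuous_on {0..T} (g \<omega>)" for \<omega>
    unfolding g_def by (intro continuous_intros continuous_on_coord)
  have coord_P: "(\<lambda>\<omega>. coord \<omega> t) \<in> borel_measurable P" for t
    using measurable_coord by (simp cong: measurable_cong_sets add: assms(5))
  have g_meas: "(\<lambda>\<omega>. g \<omega> t) \<in> borel_measurable P" for t
    unfolding g_def using coord_P assms(10) by measurable
  have solves_iff: "solves_path T b \<sigma> (X0 \<omega>) \<omega> x \<longleftrightarrow> continuous_on {0..T} x \<and>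
      (\<forall>t\<in>{0..T}. x t = volterra (\<lambda>s. b s \<omega>) (g \<omega>) x t)" for \<omega> x
    unfolding solves_path_def
  proof (intro conj_cong ball_cong refl)
    fix t assume "continuous_on {0..T} x" "t \<in> {0..T}"
    then have "set_integrable lborel {0..t} (\<lambda>s. b s \<omega> (x s))"
      by (rule lipschitz_drift.drift_integrable[OF drift])
    then show "(set_integrable lborel {0..t} (\<lambda>s. b s \<omega> (x s)) \<and>
        x t = X0 \<omega> + (LINT s:{0..t}|lborel. b s \<omega> (x s)) + \<sigma> * coord \<omega> t) \<longleftrightarrow>
        x t = volterra (\<lambda>s. b s \<omega>) (g \<omega>) x t"
      by (simp add: volterra_def g_def ac_simps)
  qed
  have "\<exists>x. solves_path T b \<sigma> (X0 \<omega>) \<omega> x \<and>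
      (\<forall>t\<in>{0..T}. (\<lambda>n. (volterra (\<lambda>s. b s \<omega>) (g \<omega>) ^^ n) (g \<omega>) t) \<longlonglongrightarrow> x t)" for \<omega>
    unfolding solves_iff by (rule lipschitz_drift.picard_converges[OF drift g_cont]) blast
  then obtain x where x: "\<And>\<omega>. solves_path T b \<sigma> (X0 \<omega>) \<omega> (x \<omega>)"
    and lim: "\<And>\<omega> t. t \<in> {0..T} \<Longrightarrow>
      (\<lambda>n. (volterra (\<lambda>s. b s \<omega>) (g \<omega>) ^^ n) (g \<omega>) t) \<longlonglongrightarrow> x \<omega> t"
    by metis
  have "(\<lambda>\<omega>. x \<omega> t) \<in> borel_measurable P" if t: "t \<in> {0..T}" for t
    by (rule borel_measurable_LIMSEQ_real[OF lim[OF t]])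
       (rule measurable_picard[OF drift assms(7) g_meas g_cont t])
  with x have sol: "is_solution P T b \<sigma> X0 (\<lambda>t \<omega>. x \<omega> t)"
    by (simp add: is_solution_def)
  have unique: "y t = x \<omega> t" if "solves_path T b \<sigma> (X0 \<omega>) \<omega> y" "t \<in> {0..T}" for \<omega> y t
    by (rule lipschitz_drift.volterra_unique[OF drift, where g = "g \<omega>"])
       (use that x[of \<omega>] in \<open>unfold solves_iff, blast+\<close>)
  show ?thesis
  proof (intro exI[of _ "\<lambda>t \<omega>. x \<omega> t"] conjI sol allI impI ballI)
    fix Y \<omega> t assume "is_solution P T b \<sigma> X0 Y" "t \<in> {0..T}"
    then show "Y t \<omega> = x \<omega> t"
      using unique[where y = "\<lambda>t. Y t \<omega>"] by (simp add: is_solution_def)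
  next
    fix Y assume "is_as_solution P T b \<sigma> X0 Y"
    then have "AE \<omega> in P. solves_path T b \<sigma> (X0 \<omega>) \<omega> (\<lambda>t. Y t \<omega>)"
      by (simp add: is_as_solution_def)
    then show "AE \<omega> in P. \<forall>t\<in>{0..T}. Y t \<omega> = x \<omega> t"
      by eventually_elim (use unique in blast)
  qed
qed

end
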